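(* Let $d\ge 1$, let $p_1,\ldots,p_d>0$ with $\sum_{k=1}^d p_k\le 1$, and let $X^*\sim(\nu^*,\mathbf P^* )$ be the generalized coupon collector chain with $N_1=\ldots=N_d=1$, i.e. on $\mathbb E^*=\{0,1\}^d$, with $\nu^*=\delta_{(0,\ldots,0)}$. Let $a_k\in(0,1)$ for $k=1,\ldots,d$. Then the chain $X\sim(\nu,\mathbf P)$ on the same state space $\mathbb E=\mathbb E^*=\{0,1\}^d$ with initial distribution $\nu=\nu^*=\delta_{(0,\ldots,0)}$ and transition matrix $$\mathbf P(\mathbf i^{(1)},\mathbf i^{(2)})=\begin{cases} a_kp_k & \text{if } \mathbf i^{(2)}=\mathbf i^{(1)}+\mathbf s_k,\\ 1-\displaystyle\sum_{j:\,i^{(1)}_j=0}a_jp_j-\sum_{j:\,i^{(1)}_j=1}(1-a_j)p_j & \text{if } \mathbf i^{(2)}=\mathbf i^{(1)},\\ (1-a_k)p_k & \text{if } \mathbf i^{(2)}=\mathbf i^{(1)}-\mathbf s_k \end{cases}$$ (all other entries being $0$) is an ergodic Markov chain which is a sharp antidual of $X^*$. Its stationary distribution is $$\pi(\mathbf i)=\prod_{j=1}^d\left[a_j\mathbf 1(i_j=1)+(1-a_j)\mathbf 1(i_j=0)\right].$$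
   Context: Notation: $\mathbf i=(i_1,\ldots,i_d)$, $\mathbf i^{(r)}=(i^{(r)}_1,\ldots,i^{(r)}_d)$; $\mathbf s_k=(0,\ldots,0,1,0,\ldots,0)$ with $1$ at position $k$, $k\in\{1,\ldots,d\}$. $\delta_{\mathbf i}$ is the point mass at $\mathbf i$. $X\sim(\nu,\mathbf P)$ means initial distribution $\nu$ and transition matrix $\mathbf P$. Ergodic means irreducible and aperiodic. Generalized coupon collector chain with all $N_j=1$: from $\mathbf i\in\{0,1\}^d$, $\mathbf P^*(\mathbf i,\mathbf i+\mathbf s_j)=p_j$ if $i_j=0$; $\mathbf P^*(\mathbf i,\mathbf i)=1-\sum_{k=1}^d p_k+\sum_{k:\,i_k=1}p_k$; all other entries are $0$. Its unique absorbing state is $\mathbf i_{max}=(1,\ldots,1)$, and $T^*$ is its absorption time there. Sharp antidual: an ergodic chain $X\sim(\nu,\mathbf P)$ with stationary distribution $\pi$ is a sharp antidual of $X^*\sim(\nu^*,\mathbf P^* )$ if there is a stochastic matrix $\Lambda$ with $\Lambda(\mathbf i_{max},\cdot)=\pi$, $\nu=\nu^*\Lambda$ and $\Lambda\mathbf P=\mathbf P^*\Lambda$, and $sep(\nu\mathbf P^k,\pi)=P(T^*>k)$ for all $k\ge0$, where $sep(\nu\mathbf P^k,\pi)=\max_{\mathbf e}(1-\nu\mathbf P^k(\mathbf e)/\pi(\mathbf e))$. *)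

theory Defs
  imports "HOL-Probability.Probability"
begin

section \<open>Finite Markov chains\<close>

text \<open>
  Distributions are row vectors and transition matrices are indexed by a finite type of states,
  with the entry from \<open>x\<close> to \<open>y\<close> being \<open>P $ x $ y\<close>; \<open>axis x 1\<close> is the point mass at \<open>x\<close>.
\<close>

definition distribution :: "real^'s \<Rightarrow> bool" where
  "distribution \<mu> \<longleftrightarrow> (\<forall>x. \<mu> $ x \<ge> 0) \<and> (\<Sum>x\<in>UNIV. \<mu> $ x) = 1"

definition stochastic :: "real^'s^'t \<Rightarrow> bool" where
  "stochastic A \<longleftrightarrow> (\<forall>x. distribution (A $ x))"

text \<open>The class operation \<open>*\<close> on vectors is componentwise, so the power has to be iterated from
  the matrix product.\<close>

definition matrix_pow :: "real^'s^'s \<Rightarrow> nat \<Rightarrow> real^'s^'s" where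
  "matrix_pow P n = (((**) P) ^^ n) (mat 1)"

definition irreducible_matrix :: "real^'s^'s \<Rightarrow> bool" where
  "irreducible_matrix P \<longleftrightarrow> (\<forall>x y. \<exists>n. matrix_pow P n $ x $ y > 0)"

definition aperiodic_matrix :: "real^'s^'s \<Rightarrow> bool" where
  "aperiodic_matrix P \<longleftrightarrow> (\<forall>x. Gcd {n. n > 0 \<and> matrix_pow P n $ x $ x > 0} = 1)"

definition ergodic_chain :: "real^'s \<Rightarrow> real^'s^'s \<Rightarrow> bool" where
  "ergodic_chain \<nu> P \<longleftrightarrow>
     distribution \<nu> \<and> stochastic P \<and> irreducible_matrix P \<and> aperiodic_matrix P"

definition stationary :: "real^'s^'s \<Rightarrow> real^'s \<Rightarrow> bool" where
  "stationary P \<rho> \<longleftrightarrow> distribution \<rho> \<and> \<rho> v* P = \<rho>"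

definition separation :: "real^'s \<Rightarrow> real^'s \<Rightarrow> real" where
  "separation \<mu> \<rho> = (MAX x. 1 - \<mu> $ x / \<rho> $ x)"

definition markov_chain ::
    "'w measure \<Rightarrow> (nat \<Rightarrow> 'w \<Rightarrow> 's) \<Rightarrow> real^'s \<Rightarrow> real^'s^'s \<Rightarrow> bool" where
  "markov_chain M X \<nu> P \<longleftrightarrow>
     prob_space M \<and>
     (\<forall>n. X n \<in> measurable M (count_space UNIV)) \<and>
     (\<forall>x. \<P>(\<omega> in M. X 0 \<omega> = x) = \<nu> $ x) \<and>
     (\<forall>n x y. \<P>(\<omega> in M. \<forall>m\<le>n. X m \<omega> = x m) \<noteq> 0 \<longrightarrow>
        \<P>(\<omega> in M. X (Suc n) \<omega> = y \<bar> \<forall>m\<le>n. X m \<omega> = x m) = P $ x n $ y)"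

text \<open>The value is \<open>\<infinity>\<close> if the path never reaches \<open>z\<close>.\<close>

definition absorption_time :: "(nat \<Rightarrow> 'w \<Rightarrow> 's) \<Rightarrow> 's \<Rightarrow> 'w \<Rightarrow> enat" where
  "absorption_time X z \<omega> = (INF n\<in>{n. X n \<omega> = z}. enat n)"

text \<open>
  The chain with initial distribution \<open>\<nu>\<close>, transition matrix \<open>P\<close> and stationary distribution
  \<open>\<rho>\<close> is a sharp antidual of the chain \<open>Y\<close> on \<open>M\<close> with initial distribution \<open>\<nu>'\<close> and transition
  matrix \<open>P'\<close>, whose unique absorbing state is \<open>z\<close>.
\<close>

definition sharp_antidual ::
    "real^'s \<Rightarrow> real^'s^'s \<Rightarrow> real^'s \<Rightarrow>
     'w measure \<Rightarrow> (nat \<Rightarrow> 'w \<Rightarrow> 't) \<Rightarrow> real^'t \<Rightarrow> real^'t^'t \<Rightarrow> 't \<Rightarrow> bool" where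
  "sharp_antidual \<nu> P \<rho> M Y \<nu>' P' z \<longleftrightarrow>
     ergodic_chain \<nu> P \<and> stationary P \<rho> \<and>
     (\<exists>\<Lambda> :: real^'s^'t. stochastic \<Lambda> \<and> \<Lambda> $ z = \<rho> \<and> \<nu> = \<nu>' v* \<Lambda> \<and> \<Lambda> ** P = P' ** \<Lambda>) \<and>
     (\<forall>k. separation (\<nu> v* matrix_pow P k) \<rho> = \<P>(\<omega> in M. absorption_time Y z \<omega> > enat k))"

section \<open>The coupon collector chain and its antidual\<close>

text \<open>
  The state space \<open>{0,1}\<^sup>d\<close> is the finite type \<open>bool^'d\<close>, with \<open>vec False\<close> and \<open>vec True\<close> being
  \<open>(0,\<dots>,0)\<close> and \<open>(1,\<dots>,1)\<close>. Addition and subtraction of a unit vector take place in \<open>int^'d\<close>.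
\<close>

definition zero_one :: "bool^'d \<Rightarrow> int^'d" where
  "zero_one i = (\<chi> j. of_bool (i $ j))"

text \<open>In both matrices below at most one \<open>k\<close> contributes to an off-diagonal entry, and
  \<open>i\<^sub>2 = i\<^sub>1 + s\<^sub>k\<close> excludes \<open>i\<^sub>2 = i\<^sub>1 - s\<^sub>l\<close>.\<close>

definition coupon_matrix :: "('d::finite \<Rightarrow> real) \<Rightarrow> real^(bool^'d)^(bool^'d)" where
  "coupon_matrix p = (\<chi> i1 i2.
     if i2 = i1 then 1 - (\<Sum>k\<in>UNIV. p k) + (\<Sum>k | i1 $ k. p k)
     else (\<Sum>k | zero_one i2 = zero_one i1 + axis k 1. p k))"

definition antidual_matrix ::
    "('d::finite \<Rightarrow> real) \<Rightarrow> ('d \<Rightarrow> real) \<Rightarrow> real^(bool^'d)^(bool^'d)" where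
  "antidual_matrix p a = (\<chi> i1 i2.
     if i2 = i1 then 1 - (\<Sum>j | \<not> i1 $ j. a j * p j) - (\<Sum>j | i1 $ j. (1 - a j) * p j)
     else (\<Sum>k | zero_one i2 = zero_one i1 + axis k 1. a k * p k)
        + (\<Sum>k | zero_one i2 = zero_one i1 - axis k 1. (1 - a k) * p k))"

definition product_distribution :: "('d::finite \<Rightarrow> real) \<Rightarrow> real^(bool^'d)" where
  "product_distribution a =
     (\<chi> i. \<Prod>j\<in>UNIV. a j * of_bool (i $ j) + (1 - a j) * of_bool (\<not> i $ j))"

end

theory Submission
  imports Defs
begin

text \<open>
  The antidual chain picks at most one coordinate per step, coordinate \<open>k\<close> with probability
  \<open>p k\<close>, and replaces that bit by a fresh one that is \<open>True\<close> with probability \<open>a k\<close>: its matrix is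
  \<open>(1 - \<Sum>p) I + \<Sum>\<^sub>k p\<^sub>k R\<^sub>k\<close> with \<open>R\<^sub>k\<close> the resampling of coordinate \<open>k\<close>
  (\<open>antidual_matrix_eq_mixture\<close>). The coupon collector is the degenerate case \<open>a = 1\<close>, in which a
  picked bit always becomes \<open>True\<close> and so records which coordinates have been picked.

  This suggests the link \<open>\<Lambda>\<close> from coupon states to bit vectors: coordinates already picked carry
  independent fresh bits, the others are still \<open>False\<close>. Resampling coordinate \<open>k\<close> after applying
  \<open>\<Lambda>\<close> is the same as first declaring \<open>k\<close> picked and then applying \<open>\<Lambda>\<close>, because a fresh bit forgets
  its past (\<open>dual_link_resample\<close>). By linearity \<open>\<Lambda> P = P\<^sup>* \<Lambda>\<close>, and the row of this identity at the
  absorbing state says that the product distribution is stationary.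

  Sharpness comes from the state \<open>(1,\<dots>,1)\<close> of the antidual. It can be occupied only when every
  coordinate has been picked, so its mass relative to \<open>\<pi>\<close> is exactly the probability that the
  coupon collector has finished, whereas at every other state the relative mass is at least that
  probability (\<open>separation_eq_absent_mass\<close>). Since the collector stays in its final state, having
  finished by time \<open>k\<close> is the same as sitting there at time \<open>k\<close> (\<open>prob_absorption_time_gt\<close>).

  As \<open>0 < a k < 1\<close>, any single bit can be set to either value, including its present one, with
  positive probability in one step. This gives irreducibility and aperiodicity, and irreducibility
  leaves room for only one stationary distribution (\<open>stationary_unique\<close>).
\<close>

section \<open>Nonnegative matrices and stationary distributions\<close>

lemma matrix_pow_0 [simp]: "matrix_pow P 0 = mat 1"
  by (simp add: matrix_pow_def)

lemma matrix_pow_Suc: "matrix_pow P (Suc n) = P ** matrix_pow P n"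
  by (simp add: matrix_pow_def)

lemma matrix_pow_Suc_right: "matrix_pow P (Suc n) = matrix_pow P n ** P"
  by (induction n) (simp_all add: matrix_pow_Suc, metis matrix_mul_assoc)

lemma matrix_pow_1 [simp]: "matrix_pow P (Suc 0) = P"
  by (simp add: matrix_pow_Suc)

lemma matrix_pow_add: "matrix_pow P (m + n) = matrix_pow P m ** matrix_pow P n"
  by (induction m) (simp_all add: matrix_pow_Suc matrix_mul_assoc)

lemma matrix_pow_nonneg:
  assumes "\<And>x y. 0 \<le> P $ x $ y"
  shows "0 \<le> matrix_pow P n $ x $ y"
  by (induction n arbitrary: x y)
     (auto simp: matrix_pow_Suc matrix_matrix_mult_def mat_def assms intro!: sum_nonneg)

lemma intertwining_matrix_pow:
  assumes "L ** P = Q ** L"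
  shows "L ** matrix_pow P n = matrix_pow Q n ** L"
proof (induction n)
  case (Suc n)
  have "L ** matrix_pow P (Suc n) = (Q ** L) ** matrix_pow P n"
    by (simp add: matrix_pow_Suc matrix_mul_assoc assms)
  also have "\<dots> = Q ** (matrix_pow Q n ** L)"
    by (simp add: Suc flip: matrix_mul_assoc)
  finally show ?case
    by (simp add: matrix_pow_Suc matrix_mul_assoc)
qed simp

lemma positive_path_trans:
  assumes "\<And>x y. 0 \<le> P $ x $ y"
    and "\<exists>m. 0 < matrix_pow P m $ x $ y" and "\<exists>n. 0 < matrix_pow P n $ y $ z"
  shows "\<exists>n. 0 < matrix_pow P n $ x $ z"
proof -
  obtain m n where mn: "0 < matrix_pow P m $ x $ y" "0 < matrix_pow P n $ y $ z"
    using assms by blast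
  then have "0 < matrix_pow P m $ x $ y * matrix_pow P n $ y $ z"
    by simp
  also have "\<dots> \<le> (\<Sum>w\<in>UNIV. matrix_pow P m $ x $ w * matrix_pow P n $ w $ z)"
    by (rule member_le_sum) (auto intro!: mult_nonneg_nonneg matrix_pow_nonneg assms)
  finally show ?thesis
    by (intro exI[of _ "m + n"]) (simp add: matrix_pow_add matrix_matrix_mult_def)
qed

lemma aperiodic_of_positive_diagonal:
  assumes "\<And>x. 0 < P $ x $ x"
  shows "aperiodic_matrix P"
  unfolding aperiodic_matrix_def
proof
  fix x
  have "Gcd {n. 0 < n \<and> 0 < matrix_pow P n $ x $ x} dvd 1"
    by (rule Gcd_dvd) (simp add: assms)
  then show "Gcd {n. 0 < n \<and> 0 < matrix_pow P n $ x $ x} = 1"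
    by simp
qed

lemma invariant_vector_matrix_pow: "h v* P = h \<Longrightarrow> h v* matrix_pow P n = h"
  by (induction n) (simp_all add: matrix_pow_Suc flip: vector_matrix_mul_assoc)

text \<open>A zero of a nonnegative invariant vector spreads backwards along positive paths: the entry at
  \<open>z\<close> of \<open>h = h P\<^sup>n\<close> is a sum of nonnegative terms, one of which is \<open>h\<^sub>y\<close> times the positive
  weight of a path from \<open>y\<close> to \<open>z\<close>.\<close>

lemma invariant_vector_eq_0:
  assumes "irreducible_matrix P" "\<And>x y. 0 \<le> P $ x $ y"
    and "h v* P = h" "\<And>x. 0 \<le> h $ x" "h $ z = 0"
  shows "h = 0"
proof -
  have "h $ y = 0" for y
  proof -
    obtain n where n: "0 < matrix_pow P n $ y $ z"
      using assms(1) by (auto simp: irreducible_matrix_def)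
    have "h $ y * matrix_pow P n $ y $ z \<le> (\<Sum>w\<in>UNIV. h $ w * matrix_pow P n $ w $ z)"
      by (rule member_le_sum) (auto intro!: mult_nonneg_nonneg matrix_pow_nonneg assms)
    also have "\<dots> = (h v* matrix_pow P n) $ z"
      by (simp add: vector_matrix_mult_def)
    also have "\<dots> = 0"
      using assms by (simp add: invariant_vector_matrix_pow)
    finally show ?thesis
      using n assms(4)[of y] by (simp add: mult_le_0_iff)
  qed
  then show ?thesis
    by (simp add: vec_eq_iff)
qed

text \<open>Subtract from \<open>\<rho>\<close> the largest multiple of \<open>\<pi>\<close> that keeps the difference nonnegative. The
  difference is invariant and vanishes somewhere, hence everywhere; both total masses being \<open>1\<close>,
  the multiple is \<open>1\<close>.\<close>

lemma stationary_unique: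
  fixes P :: "real^'s^'s"
  assumes "irreducible_matrix P" "\<And>x y. 0 \<le> P $ x $ y"
    and "stationary P \<pi>" "stationary P \<rho>"
  shows "\<rho> = \<pi>"
proof -
  have sum1: "(\<Sum>x\<in>UNIV. \<pi> $ x) = 1" "(\<Sum>x\<in>UNIV. \<rho> $ x) = 1"
    and inv: "\<pi> v* P = \<pi>" "\<rho> v* P = \<rho>"
    and nonneg: "\<And>x. 0 \<le> \<pi> $ x" "\<And>x. 0 \<le> \<rho> $ x"
    using assms(3,4) by (auto simp: stationary_def distribution_def)
  have pos: "0 < \<pi> $ x" for x
    using invariant_vector_eq_0[OF assms(1,2) inv(1) nonneg(1), of x] sum1(1) nonneg(1)[of x]
    by (auto simp: less_le)
  define c where "c = (MIN x. \<rho> $ x / \<pi> $ x)"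
  have "c \<in> range (\<lambda>x. \<rho> $ x / \<pi> $ x)"
    unfolding c_def by (rule Min_in) auto
  then obtain z where z: "c = \<rho> $ z / \<pi> $ z"
    by auto
  have le: "c * \<pi> $ x \<le> \<rho> $ x" for x
  proof -
    have "c \<le> \<rho> $ x / \<pi> $ x"
      unfolding c_def by (rule Min_le) auto
    then show ?thesis
      using pos[of x] by (simp add: field_simps)
  qed
  have "\<rho> - c *\<^sub>R \<pi> = 0"
  proof (rule invariant_vector_eq_0[OF assms(1,2)])
    show "(\<rho> - c *\<^sub>R \<pi>) v* P = \<rho> - c *\<^sub>R \<pi>"
      using inv by (simp add: vector_matrix_mult_diff_distrib scaleR_vector_matrix_assoc)
    show "(\<rho> - c *\<^sub>R \<pi>) $ z = 0"
      using pos[of z] by (simp add: z)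
  qed (use le in simp)
  then have "\<rho> = c *\<^sub>R \<pi>"
    by simp
  moreover from this have "c = 1"
    using sum1 by (simp flip: sum_distrib_left)
  ultimately show ?thesis
    by simp
qed

section \<open>Separation through a dual chain\<close>

text \<open>Every entry of \<open>\<mu> \<Lambda>\<close> contains the contribution of \<open>z\<close>, which is \<open>\<mu>\<^sub>z\<close> times the entry of
  \<open>\<rho>\<close>; this bounds the separation from above. At \<open>e\<close> nothing else contributes, so the bound is
  attained there.\<close>

lemma separation_eq_absent_mass:
  fixes \<Lambda> :: "real^'s^'t"
  assumes "stochastic \<Lambda>" "\<Lambda> $ z = \<rho>" "\<And>x. 0 < \<rho> $ x"
    and "\<And>x. x \<noteq> z \<Longrightarrow> \<Lambda> $ x $ e = 0"
    and "\<And>x. 0 \<le> \<mu> $ x"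
  shows "separation (\<mu> v* \<Lambda>) \<rho> = 1 - \<mu> $ z"
  unfolding separation_def
proof (rule Max_eqI)
  fix r assume "r \<in> range (\<lambda>x. 1 - (\<mu> v* \<Lambda>) $ x / \<rho> $ x)"
  then obtain x where r: "r = 1 - (\<mu> v* \<Lambda>) $ x / \<rho> $ x"
    by auto
  have "\<mu> $ z * \<rho> $ x \<le> (\<Sum>y\<in>UNIV. \<mu> $ y * \<Lambda> $ y $ x)"
    using member_le_sum[of z UNIV "\<lambda>y. \<mu> $ y * \<Lambda> $ y $ x"] assms
    by (auto simp: stochastic_def distribution_def)
  then show "r \<le> 1 - \<mu> $ z"
    using assms(3)[of x] by (simp add: r vector_matrix_mult_def field_simps)
next
  have "(\<mu> v* \<Lambda>) $ e = (\<Sum>y\<in>UNIV. if y = z then \<mu> $ z * \<rho> $ e else 0)"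
    unfolding vector_matrix_mult_def vec_lambda_beta
    by (rule sum.cong) (use assms(2,4) in auto)
  also have "\<dots> = \<mu> $ z * \<rho> $ e"
    by simp
  finally have "1 - \<mu> $ z = 1 - (\<mu> v* \<Lambda>) $ e / \<rho> $ e"
    using assms(3)[of e] by simp
  then show "1 - \<mu> $ z \<in> range (\<lambda>x. 1 - (\<mu> v* \<Lambda>) $ x / \<rho> $ x)"
    by auto
qed simp

section \<open>Absorption times\<close>

text \<open>The Markov property conditions on a complete history. Splitting the event \<open>X n \<omega> = x\<close> according
  to the finitely many histories that end in \<open>x\<close> turns it into a statement about two consecutive
  times, which suffices for the marginal laws and for absorption.\<close>

lemma markov_chain_step:
  fixes P :: "real^'s^'s"
  assumes "markov_chain M X \<nu> P"
  shows "\<P>(\<omega> in M. X n \<omega> = x \<and> X (Suc n) \<omega> = y) = \<P>(\<omega> in M. X n \<omega> = x) * P $ x $ y"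
proof -
  interpret prob_space M
    using assms by (simp add: markov_chain_def)
  have [measurable]: "\<And>m. X m \<in> measurable M (count_space UNIV)"
    using assms by (simp add: markov_chain_def)
  \<comment> \<open>Extensional functions, so that each history up to time \<open>n\<close> is counted once.\<close>
  define paths where "paths = {w \<in> PiE {..n} (\<lambda>_. UNIV :: 's set). w n = x}"
  have fin: "finite paths"
    unfolding paths_def by (intro finite_subset[OF _ finite_PiE[of "{..n}" "\<lambda>_. UNIV"]]) auto
  have ex1: "\<exists>!w\<in>paths. \<forall>m\<le>n. X m \<omega> = w m" if "X n \<omega> = x" for \<omega>
  proof (rule ex1I[of _ "restrict (\<lambda>m. X m \<omega>) {..n}"])
    show "v = restrict (\<lambda>m. X m \<omega>) {..n}" if "v \<in> paths \<and> (\<forall>m\<le>n. X m \<omega> = v m)" for v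
      using that by (intro PiE_ext[of v "{..n}" "\<lambda>_. UNIV"]) (auto simp: paths_def)
  qed (use that in \<open>auto simp: paths_def\<close>)
  have step: "\<P>(\<omega> in M. X (Suc n) \<omega> = y \<and> (\<forall>m\<le>n. X m \<omega> = w m)) =
      \<P>(\<omega> in M. \<forall>m\<le>n. X m \<omega> = w m) * P $ x $ y" if "w \<in> paths" for w
  proof (cases "\<P>(\<omega> in M. \<forall>m\<le>n. X m \<omega> = w m) = 0")
    case True
    have "\<P>(\<omega> in M. X (Suc n) \<omega> = y \<and> (\<forall>m\<le>n. X m \<omega> = w m)) \<le> \<P>(\<omega> in M. \<forall>m\<le>n. X m \<omega> = w m)"
      by (intro finite_measure_mono) auto
    with True show ?thesis
      by (simp add: measure_le_0_iff)
  next
    case False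
    with assms that show ?thesis
      unfolding markov_chain_def cond_prob_def paths_def by (auto simp: field_simps)
  qed
  have "\<P>(\<omega> in M. X n \<omega> = x \<and> X (Suc n) \<omega> = y) =
      (\<Sum>w\<in>paths. \<P>(\<omega> in M. X (Suc n) \<omega> = y \<and> (\<forall>m\<le>n. X m \<omega> = w m)))"
    using ex1 by (intro prob_sum fin) (auto simp: paths_def)
  also have "\<dots> = (\<Sum>w\<in>paths. \<P>(\<omega> in M. \<forall>m\<le>n. X m \<omega> = w m)) * P $ x $ y"
    by (simp add: step sum_distrib_right)
  also have "(\<Sum>w\<in>paths. \<P>(\<omega> in M. \<forall>m\<le>n. X m \<omega> = w m)) = \<P>(\<omega> in M. X n \<omega> = x)"
    using ex1 by (intro prob_sum[symmetric] fin) (auto simp: paths_def)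
  finally show ?thesis .
qed

lemma markov_chain_marginal:
  fixes P :: "real^'s^'s"
  assumes "markov_chain M X \<nu> P"
  shows "\<P>(\<omega> in M. X n \<omega> = y) = (\<nu> v* matrix_pow P n) $ y"
proof (induction n arbitrary: y)
  case 0
  then show ?case
    using assms by (simp add: markov_chain_def)
next
  case (Suc n)
  interpret prob_space M
    using assms by (simp add: markov_chain_def)
  have [measurable]: "\<And>m. X m \<in> measurable M (count_space UNIV)"
    using assms by (simp add: markov_chain_def)
  have "\<P>(\<omega> in M. X (Suc n) \<omega> = y) = (\<Sum>x\<in>UNIV. \<P>(\<omega> in M. X n \<omega> = x \<and> X (Suc n) \<omega> = y))"
    by (intro prob_sum) auto
  also have "\<dots> = ((\<nu> v* matrix_pow P n) v* P) $ y"
    by (simp add: markov_chain_step[OF assms] Suc vector_matrix_mult_def)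
  finally show ?case
    by (simp add: vector_matrix_mul_assoc matrix_pow_Suc_right)
qed

lemma absorption_time_gt_iff:
  "absorption_time X z \<omega> > enat k \<longleftrightarrow> (\<forall>n\<le>k. X n \<omega> \<noteq> z)"
proof
  assume less: "absorption_time X z \<omega> > enat k"
  show "\<forall>n\<le>k. X n \<omega> \<noteq> z"
  proof (intro allI impI notI)
    fix n assume "n \<le> k" "X n \<omega> = z"
    then have "absorption_time X z \<omega> \<le> enat n"
      unfolding absorption_time_def by (intro INF_lower) auto
    with less \<open>n \<le> k\<close> show False
      by (metis enat_ord_simps(1) leD order_trans)
  qed
next
  assume *: "\<forall>n\<le>k. X n \<omega> \<noteq> z"
  have "enat (Suc k) \<le> absorption_time X z \<omega>"
    unfolding absorption_time_def
  proof (rule INF_greatest)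
    fix n assume "n \<in> {n. X n \<omega> = z}"
    with * have "\<not> n \<le> k"
      by blast
    then show "enat (Suc k) \<le> enat n"
      by simp
  qed
  then show "absorption_time X z \<omega> > enat k"
    by (rule less_le_trans[rotated]) simp
qed

text \<open>Almost surely the chain never leaves \<open>z\<close>, so that it has visited \<open>z\<close> by time \<open>k\<close> if and only
  if it is there at time \<open>k\<close>.\<close>

lemma prob_absorption_time_gt:
  fixes P :: "real^'s^'s"
  assumes chain: "markov_chain M X \<nu> P" and absorbing: "P $ z = axis z 1"
  shows "\<P>(\<omega> in M. absorption_time X z \<omega> > enat k) = 1 - (\<nu> v* matrix_pow P k) $ z"
proof -
  interpret prob_space M
    using chain by (simp add: markov_chain_def)
  have [measurable]: "\<And>m. X m \<in> measurable M (count_space UNIV)"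
    using chain by (simp add: markov_chain_def)
  have "AE \<omega> in M. X n \<omega> = z \<longrightarrow> X (Suc n) \<omega> = z" for n
  proof -
    have "AE \<omega> in M. \<not> (X n \<omega> = z \<and> X (Suc n) \<omega> = y)" if "y \<noteq> z" for y
    proof -
      have "\<P>(\<omega> in M. X n \<omega> = z \<and> X (Suc n) \<omega> = y) = 0"
        using that by (simp add: markov_chain_step[OF chain] absorbing axis_def)
      then show ?thesis
        by (subst (asm) prob_Collect_eq_0) auto
    qed
    then have "AE \<omega> in M. \<forall>y\<in>UNIV - {z}. \<not> (X n \<omega> = z \<and> X (Suc n) \<omega> = y)"
      by (intro AE_finite_allI) auto
    then show ?thesis
      by eventually_elim auto
  qed
  then have "AE \<omega> in M. \<forall>n. X n \<omega> = z \<longrightarrow> X (Suc n) \<omega> = z"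
    by (simp add: AE_all_countable)
  then have "AE \<omega> in M. absorption_time X z \<omega> > enat k \<longleftrightarrow> X k \<omega> \<noteq> z"
  proof eventually_elim
    case (elim \<omega>)
    have "X k \<omega> = z" if "X n \<omega> = z" "n \<le> k" for n
      using that(2,1) elim by (induction rule: dec_induct) auto
    then show ?case
      by (auto simp: absorption_time_gt_iff)
  qed
  then have "\<P>(\<omega> in M. absorption_time X z \<omega> > enat k) = \<P>(\<omega> in M. X k \<omega> \<noteq> z)"
    by (intro prob_eq_AE) (simp_all add: absorption_time_gt_iff)
  then show ?thesis
    by (simp add: prob_neg markov_chain_marginal[OF chain])
qed

section \<open>Product kernels on the hypercube\<close>

lemma sum_prod_hypercube:
  fixes f :: "'d::finite \<Rightarrow> bool \<Rightarrow> real"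
  shows "(\<Sum>i\<in>UNIV. \<Prod>j\<in>UNIV. f j ((i :: bool^'d) $ j)) = (\<Prod>j\<in>UNIV. f j True + f j False)"
proof -
  have "(\<Prod>j\<in>UNIV. f j True + f j False) = (\<Prod>j\<in>UNIV. \<Sum>b\<in>UNIV. f j b)"
    by (simp add: UNIV_bool add.commute)
  also have "\<dots> = (\<Sum>g\<in>UNIV. \<Prod>j\<in>UNIV. f j (g j))"
    by (subst prod_sum_PiE) simp_all
  also have "\<dots> = (\<Sum>i\<in>UNIV. \<Prod>j\<in>UNIV. f j ((i :: bool^'d) $ j))"
    by (rule sum.reindex_bij_witness[where i = vec_nth and j = vec_lambda]) auto
  finally show ?thesis ..
qed

lemma distribution_product_distribution:
  assumes "\<And>j. 0 \<le> a j" "\<And>j. a j \<le> 1"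
  shows "distribution (product_distribution a)"
  unfolding distribution_def
proof
  show "\<forall>x. 0 \<le> product_distribution a $ x"
    using assms by (auto simp: product_distribution_def intro!: prod_nonneg add_nonneg_nonneg)
  show "(\<Sum>x\<in>UNIV. product_distribution a $ x) = 1"
    using sum_prod_hypercube[of "\<lambda>j b. a j * of_bool b + (1 - a j) * of_bool (\<not> b)"]
    by (simp add: product_distribution_def)
qed

lemma product_distribution_pos:
  assumes "\<And>j. 0 < a j" "\<And>j. a j < 1"
  shows "0 < product_distribution a $ i"
  using assms by (auto simp: product_distribution_def intro!: prod_pos)

text \<open>The bits move independently, bit \<open>j\<close> going from \<open>b\<close> to \<open>True\<close> with probability \<open>q j b\<close>. The
  identity, resampling one coordinate, and the link between the two chains all have this form.\<close>

definition product_kernel :: "('d::finite \<Rightarrow> bool \<Rightarrow> real) \<Rightarrow> real^(bool^'d)^(bool^'d)" where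
  "product_kernel q = (\<chi> i. product_distribution (\<lambda>j. q j (i $ j)))"

lemma stochastic_product_kernel:
  assumes "\<And>j b. 0 \<le> q j b" "\<And>j b. q j b \<le> 1"
  shows "stochastic (product_kernel q)"
  using assms by (simp add: stochastic_def product_kernel_def distribution_product_distribution)

text \<open>Product kernels compose one bit at a time, so identities between them reduce to identities
  between two-state kernels.\<close>

lemma product_kernel_mult:
  fixes q r :: "'d::finite \<Rightarrow> bool \<Rightarrow> real"
  shows "product_kernel q ** product_kernel r =
    product_kernel (\<lambda>j b. q j b * r j True + (1 - q j b) * r j False)"
proof -
  have "(product_kernel q ** product_kernel r) $ i $ e =
      product_kernel (\<lambda>j b. q j b * r j True + (1 - q j b) * r j False) $ i $ e" for i e
  proof -
    define f where "f j b = (q j (i $ j) * of_bool b + (1 - q j (i $ j)) * of_bool (\<not> b)) *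
      (r j b * of_bool (e $ j) + (1 - r j b) * of_bool (\<not> e $ j))" for j b
    have "(product_kernel q ** product_kernel r) $ i $ e =
        (\<Sum>m\<in>UNIV. \<Prod>j\<in>UNIV. f j (m $ j))"
      by (simp add: matrix_matrix_mult_def product_kernel_def product_distribution_def f_def
          prod.distrib)
    also have "\<dots> = (\<Prod>j\<in>UNIV. f j True + f j False)"
      by (rule sum_prod_hypercube)
    also have "\<dots> = product_kernel (\<lambda>j b. q j b * r j True + (1 - q j b) * r j False) $ i $ e"
      unfolding product_kernel_def product_distribution_def
      by (auto simp: f_def algebra_simps intro!: prod.cong)
    finally show ?thesis .
  qed
  then show ?thesis
    by (simp add: vec_eq_iff)
qed

section \<open>Coordinate resampling\<close>

definition resample :: "('d::finite \<Rightarrow> real) \<Rightarrow> 'd \<Rightarrow> real^(bool^'d)^(bool^'d)" where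
  "resample a k = product_kernel (\<lambda>j b. if j = k then a j else of_bool b)"

lemma resample_entry:
  "resample a k $ i $ e =
    (if \<forall>j. j \<noteq> k \<longrightarrow> e $ j = i $ j then if e $ k then a k else 1 - a k else 0)"
proof -
  let ?g = "\<lambda>j. (if j = k then a j else of_bool (i $ j)) * of_bool (e $ j) +
    (1 - (if j = k then a j else of_bool (i $ j))) * of_bool (\<not> e $ j)"
  have "resample a k $ i $ e = (\<Prod>j\<in>UNIV. ?g j)"
    by (simp add: resample_def product_kernel_def product_distribution_def)
  also have "\<dots> = ?g k * (\<Prod>j\<in>UNIV - {k}. ?g j)"
    by (rule prod.remove) auto
  also have "(\<Prod>j\<in>UNIV - {k}. ?g j) = (\<Prod>j\<in>UNIV - {k}. of_bool (e $ j = i $ j))"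
    by (rule prod.cong) auto
  also have "\<dots> = of_bool (\<forall>j. j \<noteq> k \<longrightarrow> e $ j = i $ j)"
    by (auto simp: prod_zero_iff intro!: prod.neutral)
  finally show ?thesis
    by simp
qed

lemma stochastic_resample:
  assumes "\<And>k. 0 \<le> a k" "\<And>k. a k \<le> 1"
  shows "stochastic (resample a k)"
  unfolding resample_def by (rule stochastic_product_kernel) (auto simp: assms)

lemma zero_one_add_axis_iff:
  "zero_one e = zero_one i + axis k 1 \<longleftrightarrow>
    \<not> i $ k \<and> e $ k \<and> (\<forall>j. j \<noteq> k \<longrightarrow> e $ j = i $ j)"
  unfolding vec_eq_iff zero_one_def axis_def by (auto simp: of_bool_def split: if_splits)

lemma zero_one_diff_axis_iff:
  "zero_one e = zero_one i - axis k 1 \<longleftrightarrow>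
    i $ k \<and> \<not> e $ k \<and> (\<forall>j. j \<noteq> k \<longrightarrow> e $ j = i $ j)"
  unfolding vec_eq_iff zero_one_def axis_def by (auto simp: of_bool_def split: if_splits)

text \<open>On the diagonal, picking \<open>k\<close> keeps the bit with probability \<open>a k\<close> or \<open>1 - a k\<close> according to
  its present value. Off the diagonal, \<open>resample a k\<close> contributes only if \<open>k\<close> is the one coordinate
  in which the two states differ, and the new value of that bit decides which of the two sums of
  \<open>antidual_matrix\<close> receives the term.\<close>

lemma antidual_matrix_eq_mixture:
  "antidual_matrix p a = (1 - (\<Sum>k\<in>UNIV. p k)) *\<^sub>R mat 1 + (\<Sum>k\<in>UNIV. p k *\<^sub>R resample a k)"
proof -
  have "antidual_matrix p a $ i $ e =
      (1 - (\<Sum>k\<in>UNIV. p k)) * of_bool (i = e) + (\<Sum>k\<in>UNIV. p k * resample a k $ i $ e)" for i e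
  proof (cases "e = i")
    case True
    have "(\<Sum>k\<in>UNIV. p k) - (\<Sum>k | \<not> i $ k. a k * p k) - (\<Sum>k | i $ k. (1 - a k) * p k) =
        (\<Sum>k\<in>UNIV. p k - (if \<not> i $ k then a k * p k else 0) -
          (if i $ k then (1 - a k) * p k else 0))"
      by (simp add: sum_subtractf sum.If_cases)
    also have "\<dots> = (\<Sum>k\<in>UNIV. p k * resample a k $ i $ i)"
      by (rule sum.cong) (auto simp: resample_entry algebra_simps)
    finally show ?thesis
      by (simp add: True antidual_matrix_def)
  next
    case False
    have "(\<Sum>k\<in>UNIV. p k * resample a k $ i $ e) =
        (\<Sum>k\<in>UNIV. (if zero_one e = zero_one i + axis k 1 then a k * p k else 0) +
          (if zero_one e = zero_one i - axis k 1 then (1 - a k) * p k else 0))"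
    proof (rule sum.cong)
      fix k
      have "e $ k \<noteq> i $ k" if "\<forall>j. j \<noteq> k \<longrightarrow> e $ j = i $ j"
      proof -
        obtain j where "e $ j \<noteq> i $ j"
          using False by (auto simp: vec_eq_iff)
        with that show ?thesis
          by (cases "j = k") auto
      qed
      then show "p k * resample a k $ i $ e =
          (if zero_one e = zero_one i + axis k 1 then a k * p k else 0) +
          (if zero_one e = zero_one i - axis k 1 then (1 - a k) * p k else 0)"
        by (auto simp: resample_entry zero_one_add_axis_iff zero_one_diff_axis_iff)
    qed simp
    also have "\<dots> = antidual_matrix p a $ i $ e"
      using False by (simp add: antidual_matrix_def sum.distrib sum.If_cases)
    finally show ?thesis
      using False by simp
  qed
  then show ?thesis
    by (auto simp: vec_eq_iff mat_def)
qed

text \<open>With \<open>a = 1\<close> a resampled bit is always \<open>True\<close>: the coupon collector marks the coordinate that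
  it draws.\<close>

lemma coupon_matrix_eq_antidual_matrix: "coupon_matrix p = antidual_matrix p (\<lambda>_. 1)"
proof -
  have "1 - (\<Sum>k\<in>UNIV. p k) + (\<Sum>k | i $ k. p k) = 1 - (\<Sum>k | \<not> i $ k. p k)" for i :: "bool^'a"
    using sum.If_cases[of "UNIV :: 'a set" "\<lambda>k. i $ k" p p] by (simp add: Collect_neg_eq)
  then show ?thesis
    by (simp add: coupon_matrix_def antidual_matrix_def vec_eq_iff)
qed

lemma coupon_matrix_absorbing: "coupon_matrix p $ vec True = axis (vec True) 1"
proof -
  have "resample (\<lambda>_. 1) k $ vec True = axis (vec True) 1" for k :: 'a
    by (auto simp: vec_eq_iff resample_entry axis_def)
  then show ?thesis
    by (auto simp: coupon_matrix_eq_antidual_matrix antidual_matrix_eq_mixture vec_eq_iff mat_def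
        axis_def simp flip: sum_distrib_right)
qed

lemma stochastic_antidual_matrix:
  assumes "\<And>k. 0 \<le> p k" "(\<Sum>k\<in>UNIV. p k) \<le> 1" "\<And>k. 0 \<le> a k" "\<And>k. a k \<le> 1"
  shows "stochastic (antidual_matrix p a)"
proof -
  have res: "\<And>k x y. 0 \<le> resample a k $ x $ y" "\<And>k x. (\<Sum>y\<in>UNIV. resample a k $ x $ y) = 1"
    using stochastic_resample[of a] assms by (auto simp: stochastic_def distribution_def)
  have "(\<Sum>y\<in>UNIV. \<Sum>k\<in>UNIV. p k * resample a k $ x $ y) = (\<Sum>k\<in>UNIV. p k)" for x
    by (subst sum.swap) (simp add: res flip: sum_distrib_left)
  then show ?thesis
    using assms
    by (auto simp: stochastic_def distribution_def antidual_matrix_eq_mixture mat_def sum.distrib res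
        intro!: add_nonneg_nonneg sum_nonneg simp flip: sum_distrib_left)
qed

text \<open>The case \<open>e = i\<close> is included: resampling a bit may return its present value, so that all
  holding probabilities are positive even if \<open>\<Sum>p = 1\<close>.\<close>

lemma antidual_matrix_pos:
  assumes "\<And>k. 0 < p k" "(\<Sum>k\<in>UNIV. p k) \<le> 1" "\<And>k. 0 < a k" "\<And>k. a k < 1"
    and "\<forall>j. j \<noteq> k \<longrightarrow> e $ j = i $ j"
  shows "0 < antidual_matrix p a $ i $ e"
proof -
  have nonneg: "0 \<le> resample a l $ i $ e" for l
    using assms(3,4)[of l] by (simp add: resample_entry)
  have "0 < p k * resample a k $ i $ e"
    using assms by (simp add: resample_entry)
  also have "\<dots> \<le> (\<Sum>l\<in>UNIV. p l * resample a l $ i $ e)"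
    by (rule member_le_sum) (auto intro!: mult_nonneg_nonneg nonneg less_imp_le[OF assms(1)])
  also have "\<dots> \<le> antidual_matrix p a $ i $ e"
    using assms(2) by (simp add: antidual_matrix_eq_mixture mat_def)
  finally show ?thesis .
qed

lemma ergodic_antidual_matrix:
  fixes p a :: "'d::finite \<Rightarrow> real"
  assumes "\<And>k. 0 < p k" "(\<Sum>k\<in>UNIV. p k) \<le> 1" "\<And>k. 0 < a k" "\<And>k. a k < 1"
    and "distribution \<nu>"
  shows "ergodic_chain \<nu> (antidual_matrix p a)"
proof -
  let ?P = "antidual_matrix p a"
  have stoch: "stochastic ?P"
    by (rule stochastic_antidual_matrix) (auto intro: less_imp_le assms)
  then have nonneg: "\<And>x y. 0 \<le> ?P $ x $ y"
    by (simp add: stochastic_def distribution_def)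
  have "\<exists>n. 0 < matrix_pow ?P n $ x $ y" for x y
  proof -
    \<comment> \<open>The bits of \<open>x\<close> are set to those of \<open>y\<close> one coordinate at a time.\<close>
    have "\<exists>n. 0 < matrix_pow ?P n $ x $ (\<chi> j. if j \<in> D then y $ j else x $ j)"
      if "finite D" for D
      using that
    proof (induction D)
      case empty
      show ?case
        by (intro exI[of _ 0]) (simp add: mat_def)
    next
      case (insert k D)
      have "0 < ?P $ (\<chi> j. if j \<in> D then y $ j else x $ j) $
          (\<chi> j. if j \<in> insert k D then y $ j else x $ j)"
        by (rule antidual_matrix_pos[where k = k]) (auto simp: assms)
      then have "\<exists>n. 0 < matrix_pow ?P n $ (\<chi> j. if j \<in> D then y $ j else x $ j) $
          (\<chi> j. if j \<in> insert k D then y $ j else x $ j)"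
        by (intro exI[of _ "Suc 0"]) simp
      with insert.IH show ?case
        by (rule positive_path_trans[OF nonneg])
    qed
    from this[of UNIV] show ?thesis
      by simp
  qed
  \<comment> \<open>Any coordinate shows that the chain can stay put; \<open>undefined\<close> serves as one.\<close>
  moreover have "0 < ?P $ x $ x" for x
    by (rule antidual_matrix_pos[where k = undefined]) (auto simp: assms)
  ultimately show ?thesis
    using stoch assms(5)
    by (simp add: ergodic_chain_def irreducible_matrix_def aperiodic_of_positive_diagonal)
qed

section \<open>The duality\<close>

text \<open>Given a set of drawn coupons, the law of the bits of the antidual chain: coordinates drawn at
  least once carry fresh bits, the others still have their initial value \<open>False\<close>.\<close>

definition dual_link :: "('d::finite \<Rightarrow> real) \<Rightarrow> real^(bool^'d)^(bool^'d)" where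
  "dual_link a = product_kernel (\<lambda>j b. if b then a j else 0)"

lemma dual_link_top: "dual_link a $ vec True = product_distribution a"
  by (simp add: dual_link_def product_kernel_def)

lemma dual_link_bottom: "dual_link a $ vec False = axis (vec False) 1"
proof -
  have "(\<Prod>j\<in>UNIV. of_bool (\<not> e $ j)) = (of_bool (e = vec False) :: real)" for e :: "bool^'a"
  proof (cases "e = vec False")
    case False
    then obtain j where "e $ j"
      by (auto simp: vec_eq_iff)
    then show ?thesis
      using False by auto
  qed simp
  then show ?thesis
    by (auto simp: vec_eq_iff dual_link_def product_kernel_def product_distribution_def axis_def)
qed

lemma dual_link_to_top_eq_0:
  assumes "i \<noteq> vec True"
  shows "dual_link a $ i $ vec True = 0"
proof -
  obtain j where "\<not> i $ j"
    using assms by (auto simp: vec_eq_iff)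
  then show ?thesis
    by (auto simp: dual_link_def product_kernel_def product_distribution_def intro!: prod_zero)
qed

text \<open>On bit \<open>k\<close> both sides yield a fresh bit, whatever happened before; the other bits see only
  the link.\<close>

lemma dual_link_resample: "dual_link a ** resample a k = resample (\<lambda>_. 1) k ** dual_link a"
  unfolding dual_link_def resample_def product_kernel_mult
  by (rule arg_cong[where f = product_kernel]) (auto simp: fun_eq_iff algebra_simps)

lemma matrix_mul_add_left:
  fixes A :: "real^'n^'m"
  shows "(B + C) ** A = B ** A + C ** A"
  by (simp add: vec_eq_iff matrix_matrix_mult_def distrib_right sum.distrib)

lemma matrix_mul_sum_right:
  fixes A :: "real^'n^'m"
  shows "A ** (\<Sum>k\<in>K. B k) = (\<Sum>k\<in>K. A ** B k)"
  by (induction K rule: infinite_finite_induct) (simp_all add: matrix_add_ldistrib)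

lemma matrix_mul_sum_left:
  fixes A :: "real^'n^'m"
  shows "(\<Sum>k\<in>K. B k) ** A = (\<Sum>k\<in>K. B k ** A)"
  by (induction K rule: infinite_finite_induct) (simp_all add: matrix_mul_add_left)

lemma dual_link_intertwines:
  "dual_link a ** antidual_matrix p a = coupon_matrix p ** dual_link a"
  by (simp add: coupon_matrix_eq_antidual_matrix antidual_matrix_eq_mixture matrix_add_ldistrib
      matrix_mul_add_left matrix_mul_sum_right matrix_mul_sum_left matrix_scalar_ac
      dual_link_resample flip: scalar_matrix_assoc)

section \<open>The sharp antidual of the coupon collector\<close>

theorem theorem4p6:
  fixes p a :: "'d::finite \<Rightarrow> real"
    and M :: "'w measure"
    and Y :: "nat \<Rightarrow> 'w \<Rightarrow> bool^'d"
  assumes "\<And>k. p k > 0"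
    and "(\<Sum>k\<in>UNIV. p k) \<le> 1"
    and "\<And>k. 0 < a k" and "\<And>k. a k < 1"
    and "markov_chain M Y (axis (vec False) 1) (coupon_matrix p)"
  shows "ergodic_chain (axis (vec False) 1) (antidual_matrix p a) \<and>
    sharp_antidual (axis (vec False) 1) (antidual_matrix p a) (product_distribution a)
      M Y (axis (vec False) 1) (coupon_matrix p) (vec True) \<and>
    (\<forall>\<rho>. stationary (antidual_matrix p a) \<rho> \<longleftrightarrow> \<rho> = product_distribution a)"
proof -
  let ?P = "antidual_matrix p a" and ?Q = "coupon_matrix p" and ?L = "dual_link a"
    and ?\<pi> = "product_distribution a" and ?\<nu> = "axis (vec False) 1 :: real^(bool^'d)"
  have axis_mult: "axis x 1 v* A = A $ x" for x :: "bool^'d" and A :: "real^(bool^'d)^(bool^'d)"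
  proof -
    have "(\<Sum>y\<in>UNIV. axis x 1 $ y * A $ y $ e) = (\<Sum>y\<in>UNIV. if y = x then A $ x $ e else 0)" for e
      by (rule sum.cong) (auto simp: axis_def)
    then show ?thesis
      by (intro vec_eq_iff[THEN iffD2] allI) (simp add: vector_matrix_mult_def)
  qed
  have ergodic: "ergodic_chain ?\<nu> ?P"
    by (intro ergodic_antidual_matrix assms) (simp add: distribution_def axis_def)
  have link: "stochastic ?L"
    unfolding dual_link_def using assms(3,4)
    by (intro stochastic_product_kernel) (auto intro: less_imp_le)
  have nonneg: "0 \<le> ?P $ x $ y" "0 \<le> ?Q $ x $ y" for x y
  proof -
    have "stochastic ?P"
      using ergodic by (simp add: ergodic_chain_def)
    moreover have "stochastic ?Q"
      unfolding coupon_matrix_eq_antidual_matrix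
      by (rule stochastic_antidual_matrix) (auto intro: less_imp_le assms)
    ultimately show "0 \<le> ?P $ x $ y" "0 \<le> ?Q $ x $ y"
      by (auto simp: stochastic_def distribution_def)
  qed
  have \<nu>: "?\<nu> v* ?L = ?\<nu>"
    by (simp add: axis_mult dual_link_bottom)

  \<comment> \<open>Stationarity is the intertwining relation read at the absorbing state.\<close>
  have "?\<pi> v* ?P = (axis (vec True) 1 v* ?L) v* ?P"
    by (simp add: axis_mult dual_link_top)
  also have "\<dots> = (axis (vec True) 1 v* ?Q) v* ?L"
    by (simp add: vector_matrix_mul_assoc dual_link_intertwines)
  also have "\<dots> = ?\<pi>"
    by (simp add: axis_mult coupon_matrix_absorbing dual_link_top)
  finally have stat: "stationary ?P ?\<pi>"
    using assms(3,4) by (simp add: stationary_def distribution_product_distribution less_imp_le)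

  have sep: "separation (?\<nu> v* matrix_pow ?P k) ?\<pi> =
      \<P>(\<omega> in M. absorption_time Y (vec True) \<omega> > enat k)" for k
  proof -
    \<comment> \<open>The law of the antidual at time \<open>k\<close> is the image of the law of the collector under the link.\<close>
    have "?\<nu> v* matrix_pow ?P k = (?\<nu> v* ?L) v* matrix_pow ?P k"
      by (simp add: \<nu>)
    also have "\<dots> = (?\<nu> v* matrix_pow ?Q k) v* ?L"
      by (simp add: vector_matrix_mul_assoc intertwining_matrix_pow[OF dual_link_intertwines])
    also have "separation \<dots> ?\<pi> = 1 - (?\<nu> v* matrix_pow ?Q k) $ vec True"
    proof (rule separation_eq_absent_mass[where e = "vec True"])
      show "0 \<le> (?\<nu> v* matrix_pow ?Q k) $ x" for x
        by (simp add: axis_mult matrix_pow_nonneg nonneg)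
    qed (simp_all add: link dual_link_top dual_link_to_top_eq_0 product_distribution_pos assms)
    also have "\<dots> = \<P>(\<omega> in M. absorption_time Y (vec True) \<omega> > enat k)"
      by (rule prob_absorption_time_gt[OF assms(5) coupon_matrix_absorbing, symmetric])
    finally show ?thesis .
  qed

  have "sharp_antidual ?\<nu> ?P ?\<pi> M Y ?\<nu> ?Q (vec True)"
    unfolding sharp_antidual_def
    using ergodic stat link \<nu> sep dual_link_top[of a] dual_link_intertwines[of a p] by metis
  moreover have "\<rho> = ?\<pi>" if "stationary ?P \<rho>" for \<rho>
    using ergodic stat that nonneg(1)
    by (intro stationary_unique[of ?P]) (auto simp: ergodic_chain_def)
  ultimately show ?thesis
    using ergodic stat by blast
qed

end
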